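(* Let $M$ be an irreducible based module of rank $2$ over the complex representation ring $r(S_4)$ of the symmetric group $S_4$. Then $M$ is equivalent to one of the following based modules $M_{2,1},M_{2,2},M_{2,3}$, given by the matrices of $V_\psi,V_{\rho_1},V_{\rho_2}$ (with $V_{\rho_3}=V_\psi V_{\rho_2}$ acting by the product of the matrices of $V_\psi$ and $V_{\rho_2}$): $M_{2,1}$: $V_\psi\mapsto\begin{pmatrix}1&0\\0&1\end{pmatrix}$, $V_{\rho_1}\mapsto\begin{pmatrix}2&0\\0&2\end{pmatrix}$, $V_{\rho_2}\mapsto\begin{pmatrix}1&2\\2&1\end{pmatrix}$; $M_{2,2}$: $V_\psi\mapsto\begin{pmatrix}0&1\\1&0\end{pmatrix}$, $V_{\rho_1}\mapsto\begin{pmatrix}1&1\\1&1\end{pmatrix}$, $V_{\rho_2}\mapsto\begin{pmatrix}2&1\\1&2\end{pmatrix}$; $M_{2,3}$: $V_\psi\mapsto\begin{pmatrix}0&1\\1&0\end{pmatrix}$, $V_{\rho_1}\mapsto\begin{pmatrix}1&1\\1&1\end{pmatrix}$, $V_{\rho_2}\mapsto\begin{pmatrix}1&2\\2&1\end{pmatrix}$.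
   Context: The ring $r(S_4)$ is the Grothendieck ring of finite-dimensional complex representations of $S_4$. It is commutative and free over $\mathbb{Z}$ with basis $\{1,V_\psi,V_{\rho_1},V_{\rho_2},V_{\rho_3}\}$, the classes of the irreducible representations: trivial, sign, the 2-dimensional one, the 3-dimensional standard one, and $V_{\rho_3}=V_\psi V_{\rho_2}$. The products are determined by $V_\psi^2=1$, $V_\psi V_{\rho_1}=V_{\rho_1}$, $V_\psi V_{\rho_2}=V_{\rho_3}$, $V_{\rho_1}^2=1+V_\psi+V_{\rho_1}$, $V_{\rho_1}V_{\rho_2}=V_{\rho_2}+V_{\rho_3}$, $V_{\rho_2}^2=1+V_{\rho_1}+V_{\rho_2}+V_{\rho_3}$. All basis elements are self-dual. A $\mathbb{Z}_+$-module over $r(S_4)$ is an $r(S_4)$-module $M$ (with $1$ acting as identity) together with a fixed $\mathbb{Z}$-basis in which each basis element of $r(S_4)$ acts by a matrix with non-negative integer entries. Its rank is the size of the basis. It is a based module if, moreover, the matrix of each basis element of $r(S_4)$ is symmetric (this is the general condition $a_{il}^k=a_{i^*k}^l$ on structure constants $b_i m_l=\sum_k a_{il}^k m_k$, since here $i^*=i$). It is irreducible if it is nonzero and no nonempty proper subset of the fixed basis spans an $r(S_4)$-submodule. Two $\mathbb{Z}_+$-modules are equivalent if some bijection between their fixed bases induces an isomorphism of $r(S_4)$-modules, i.e. the representing matrices are simultaneously conjugate by a permutation matrix. *)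

theory Defs
  imports "HOL-Analysis.Analysis" "HOL-Combinatorics.Permutations"
begin

section \<open>The representation ring of the symmetric group on four letters\<close>

text \<open>
  The Grothendieck ring $r(S_4)$ is the free abelian group on the five irreducible complex
  representations (in the order of \<open>irr\<close>: trivial, sign, two-dimensional, standard, and sign times
  standard), multiplied by decomposing tensor products. The function \<open>tensor\<close> lists the irreducible constituents, with
  multiplicity, of the tensor product of two irreducibles. The lemma
  \<open>irr_char_tensor\<close> below shows that the characters multiply in the same way.
\<close>

datatype irr = Triv | Psi | Rho1 | Rho2 | Rho3

fun tensor :: "irr \<Rightarrow> irr \<Rightarrow> irr list" where
  "tensor Triv j = [j]"
| "tensor i Triv = [i]"
| "tensor Psi Psi = [Triv]"
| "tensor Psi Rho1 = [Rho1]"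
| "tensor Psi Rho2 = [Rho3]"
| "tensor Psi Rho3 = [Rho2]"
| "tensor Rho1 Psi = [Rho1]"
| "tensor Rho1 Rho1 = [Triv, Psi, Rho1]"
| "tensor Rho1 Rho2 = [Rho2, Rho3]"
| "tensor Rho1 Rho3 = [Rho2, Rho3]"
| "tensor Rho2 Psi = [Rho3]"
| "tensor Rho2 Rho1 = [Rho2, Rho3]"
| "tensor Rho2 Rho2 = [Triv, Rho1, Rho2, Rho3]"
| "tensor Rho2 Rho3 = [Psi, Rho1, Rho2, Rho3]"
| "tensor Rho3 Psi = [Rho2]"
| "tensor Rho3 Rho1 = [Rho2, Rho3]"
| "tensor Rho3 Rho2 = [Psi, Rho1, Rho2, Rho3]"
| "tensor Rho3 Rho3 = [Triv, Rho1, Rho2, Rho3]"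

lemma UNIV_irr: "UNIV = {Triv, Psi, Rho1, Rho2, Rho3}"
  using irr.exhaust by auto

instance irr :: finite
  by standard (simp add: UNIV_irr)

lemma all_irr: "(\<forall>i. P i) \<longleftrightarrow> P Triv \<and> P Psi \<and> P Rho1 \<and> P Rho2 \<and> P Rho3"
  by (metis irr.exhaust)

lemma sum_irr:
  "(\<Sum>i\<in>UNIV. f i) = f Triv + f Psi + f Rho1 + f Rho2 + (f Rho3 :: 'a :: comm_monoid_add)"
  by (simp add: UNIV_irr add.assoc)

text \<open>An element of the ring is given by its coordinates in the basis of irreducibles.\<close>

datatype rS4 = RS4 (coord: "irr \<Rightarrow> int")

lemma rS4_eq_iff: "x = y \<longleftrightarrow> (\<forall>k. coord x k = coord y k)"
  by (cases x; cases y) auto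

instantiation rS4 :: comm_ring_1
begin

definition "0 = RS4 (\<lambda>k. 0)"
definition "1 = RS4 (\<lambda>k. if k = Triv then 1 else 0)"
definition "x + y = RS4 (\<lambda>k. coord x k + coord y k)"
definition "x - y = RS4 (\<lambda>k. coord x k - coord y k)"
definition "- x = RS4 (\<lambda>k. - coord x k)"
definition "x * y = RS4 (\<lambda>k. \<Sum>i\<in>UNIV. \<Sum>j\<in>UNIV.
    coord x i * coord y j * int (count_list (tensor i j) k))"

lemma coord_times:
    "coord (x * y) Triv = coord x Triv * coord y Triv + coord x Psi * coord y Psi + coord x Rho1
     * coord y Rho1 + coord x Rho2 * coord y Rho2 + coord x Rho3 * coord y Rho3"
    "coord (x * y) Psi = coord x Triv * coord y Psi + coord x Psi * coord y Triv + coord x Rho1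
     * coord y Rho1 + coord x Rho2 * coord y Rho3 + coord x Rho3 * coord y Rho2"
    "coord (x * y) Rho1 = coord x Triv * coord y Rho1 + coord x Psi * coord y Rho1 + coord x
     Rho1 * coord y Triv + coord x Rho1 * coord y Psi + coord x Rho1 * coord y Rho1 + coord x
     Rho2 * coord y Rho2 + coord x Rho2 * coord y Rho3 + coord x Rho3 * coord y Rho2 + coord x
     Rho3 * coord y Rho3"
    "coord (x * y) Rho2 = coord x Triv * coord y Rho2 + coord x Psi * coord y Rho3 + coord x
     Rho1 * coord y Rho2 + coord x Rho1 * coord y Rho3 + coord x Rho2 * coord y Triv + coord x
     Rho2 * coord y Rho1 + coord x Rho2 * coord y Rho2 + coord x Rho2 * coord y Rho3 + coord x
     Rho3 * coord y Psi + coord x Rho3 * coord y Rho1 + coord x Rho3 * coord y Rho2 + coord x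
     Rho3 * coord y Rho3"
    "coord (x * y) Rho3 = coord x Triv * coord y Rho3 + coord x Psi * coord y Rho2 + coord x
     Rho1 * coord y Rho2 + coord x Rho1 * coord y Rho3 + coord x Rho2 * coord y Psi + coord x
     Rho2 * coord y Rho1 + coord x Rho2 * coord y Rho2 + coord x Rho2 * coord y Rho3 + coord x
     Rho3 * coord y Triv + coord x Rho3 * coord y Rho1 + coord x Rho3 * coord y Rho2 + coord x
     Rho3 * coord y Rho3"
  by (simp_all add: times_rS4_def sum_irr)

instance
proof
  fix a b c :: rS4
  show "a * b * c = a * (b * c)"
    unfolding rS4_eq_iff all_irr coord_times by (intro conjI; algebra)
  show "a * b = b * a"
    unfolding rS4_eq_iff all_irr coord_times by (simp add: algebra_simps)
  show "1 * a = a"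
    unfolding rS4_eq_iff all_irr coord_times by (simp add: one_rS4_def)
  show "(a + b) * c = a * c + b * c"
    by (simp add: rS4_eq_iff all_irr coord_times plus_rS4_def algebra_simps)
qed (simp_all add: rS4_eq_iff zero_rS4_def one_rS4_def plus_rS4_def minus_rS4_def uminus_rS4_def
    all_irr)

end

definition V :: "irr \<Rightarrow> rS4" where
  "V i = RS4 (\<lambda>k. if k = i then 1 else 0)"

lemma V_Triv: "V Triv = 1"
  by (simp add: V_def one_rS4_def)

lemma V_products:
  "V Psi * V Psi = 1"
  "V Psi * V Rho1 = V Rho1"
  "V Psi * V Rho2 = V Rho3"
  "V Rho1 * V Rho1 = 1 + V Psi + V Rho1"
  "V Rho1 * V Rho2 = V Rho2 + V Rho3"
  "V Rho2 * V Rho2 = 1 + V Rho1 + V Rho2 + V Rho3"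
  by (simp_all add: rS4_eq_iff times_rS4_def one_rS4_def plus_rS4_def V_def all_irr sum_irr)

text \<open>
  The irreducible characters of the group of permutations of \<open>{1, 2, 3, 4}\<close>: \<open>\<rho>\<^sub>2\<close> is the
  permutation representation on the four letters minus the trivial one, and \<open>\<rho>\<^sub>1\<close> is the permutation
  representation on the three ways to split the letters into two pairs, minus the trivial one.
\<close>

definition pairings :: "nat set set set" where
  "pairings = {{{1,2},{3,4}}, {{1,3},{2,4}}, {{1,4},{2,3}}}"

fun irr_char :: "irr \<Rightarrow> (nat \<Rightarrow> nat) \<Rightarrow> int" where
  "irr_char Triv p = 1"
| "irr_char Psi p = sign p"
| "irr_char Rho1 p = int (card {P \<in> pairings. (`) p ` P = P}) - 1"
| "irr_char Rho2 p = int (card {x \<in> {1,2,3,4}. p x = x}) - 1"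
| "irr_char Rho3 p = sign p * (int (card {x \<in> {1,2,3,4}. p x = x}) - 1)"

lemma permutes4:
  assumes "p permutes {1,2,3,4::nat}"
  shows "\<exists>b\<in>{1,2,3,4}. \<exists>c\<in>{2,3,4}. \<exists>d\<in>{3,4}.
    p = Transposition.transpose 1 b \<circ>
      (Transposition.transpose 2 c \<circ> Transposition.transpose 3 d)"
proof -
  have "p \<in> {p. p permutes {1,2,3,4::nat}}" using assms by simp
  then show ?thesis
    unfolding permutes_insert by (auto simp: permutes_insert)
qed

lemma card_fixed_letters:
  "int (card {x \<in> {1,2,3,4::nat}. p x = x}) = (\<Sum>x\<in>{1,2,3,4}. if p x = x then 1 else 0)"
  by (subst sum.inter_filter[symmetric]) auto

lemma card_fixed_pairings:
  "int (card {P \<in> pairings. (`) p ` P = P}) =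
   (if (`) p ` {{1,2},{3,4}} = {{1,2},{3,4}} then 1 else 0) +
   (if (`) p ` {{1,3},{2,4}} = {{1,3},{2,4}} then 1 else 0) +
   (if (`) p ` {{1,4},{2,3}} = {{1,4},{2,3}} then 1 else 0)"
proof -
  have "int (card {P \<in> pairings. (`) p ` P = P}) =
      (\<Sum>P\<in>pairings. if (`) p ` P = P then 1 else 0)"
    by (subst sum.inter_filter[symmetric]) (auto simp: pairings_def)
  moreover have "{{1,2},{3,4}} \<noteq> {{1,3},{2,4::nat}}" "{{1,2},{3,4}} \<noteq> {{1,4},{2,3::nat}}"
    "{{1,3},{2,4}} \<noteq> {{1,4},{2,3::nat}}"
    by (auto simp: doubleton_eq_iff)
  ultimately show ?thesis by (simp add: pairings_def)
qed

lemma irr_char_values: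
  assumes "p permutes {1,2,3,4}"
  shows "(irr_char Psi p, irr_char Rho1 p, irr_char Rho2 p) \<in>
    {(1,2,3), (-1,0,1), (1,2,-1), (1,-1,0), (-1,0,-1)}"
proof -
  obtain b c d where bcd: "b \<in> {1,2,3,4}" "c \<in> {2,3,4}" "d \<in> {3,4}"
    and p: "p = Transposition.transpose 1 b \<circ>
      (Transposition.transpose 2 c \<circ> Transposition.transpose 3 d)"
    using permutes4[OF assms] by blast
  have s: "sign p = (if 1 = b then 1 else -1) *
      ((if 2 = c then 1 else -1) * (if 3 = d then 1 else -1))"
    unfolding p
    by (simp add: sign_compose permutation_compose permutation_swap_id sign_swap_id)
  have "(sign p, p 1, p 2, p 3, p 4) \<in> {
      (1,1,2,3,4), (-1,1,2,4,3), (-1,1,3,2,4), (1,1,3,4,2),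
      (1,1,4,2,3), (-1,1,4,3,2), (-1,2,1,3,4), (1,2,1,4,3),
      (1,2,3,1,4), (-1,2,3,4,1), (-1,2,4,1,3), (1,2,4,3,1),
      (1,3,1,2,4), (-1,3,1,4,2), (-1,3,2,1,4), (1,3,2,4,1),
      (1,3,4,1,2), (-1,3,4,2,1), (-1,4,1,2,3), (1,4,1,3,2),
      (1,4,2,1,3), (-1,4,2,3,1), (-1,4,3,1,2), (1,4,3,2,1)}"
    using bcd unfolding s unfolding p
    by (elim insertE emptyE; simp add: Transposition.transpose_def)
  then show ?thesis
    by (simp only: irr_char.simps card_fixed_pairings card_fixed_letters image_insert image_empty)
      (elim insertE emptyE; simp add: doubleton_eq_iff)
qed

lemma irr_char_tensor:
  assumes "p permutes {1,2,3,4}"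
  shows "irr_char i p * irr_char j p = (\<Sum>k\<leftarrow>tensor i j. irr_char k p)"
proof -
  have gen: "f i * f j = (\<Sum>k\<leftarrow>tensor i j. f k)"
    if "(f Psi, f Rho1, f Rho2) \<in> {(1,2,3), (-1,0,1), (1,2,-1), (1,-1,0), (-1,0,-1)}"
      "f Triv = 1" "f Rho3 = f Psi * f Rho2"
    for f :: "irr \<Rightarrow> int"
    using that(1)
    by (cases i; cases j) (elim insertE emptyE; simp add: that(2,3))+
  show ?thesis
    by (rule gen[of "\<lambda>i. irr_char i p"]) (use irr_char_values[OF assms] in simp_all)
qed

section \<open>Modules with a non-negative basis\<close>

text \<open>
  A module over \<open>r(S\<^sub>4)\<close> is a scalar multiplication \<open>s\<close> on a type \<open>'m\<close> of class \<open>ab_group_add\<close>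
  satisfying the library predicate \<open>module\<close>. Its underlying abelian group is the
  \<open>\<int>\<close>-module obtained by restriction of scalars along \<open>of_int\<close>.
\<close>

definition int_scale :: "(rS4 \<Rightarrow> 'm \<Rightarrow> 'm) \<Rightarrow> int \<Rightarrow> 'm \<Rightarrow> 'm :: ab_group_add" where
  "int_scale s n = s (of_int n)"

definition is_Z_basis :: "(rS4 \<Rightarrow> 'm \<Rightarrow> 'm) \<Rightarrow> 'm :: ab_group_add set \<Rightarrow> bool" where
  "is_Z_basis s B \<longleftrightarrow>
     \<not> module.dependent (int_scale s) B \<and> module.span (int_scale s) B = UNIV"

text \<open>The structure constant \<open>act_coeff s B i l k\<close> is the coefficient of \<open>k \<in> B\<close> in \<open>V i\<close> acting on \<open>l \<in> B\<close>.\<close>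

definition act_coeff ::
  "(rS4 \<Rightarrow> 'm \<Rightarrow> 'm) \<Rightarrow> 'm :: ab_group_add set \<Rightarrow> irr \<Rightarrow> 'm \<Rightarrow> 'm \<Rightarrow> int" where
  "act_coeff s B i l k = module.representation (int_scale s) B (s (V i) l) k"

definition Zplus_module :: "(rS4 \<Rightarrow> 'm \<Rightarrow> 'm) \<Rightarrow> 'm :: ab_group_add set \<Rightarrow> bool" where
  "Zplus_module s B \<longleftrightarrow> module s \<and> is_Z_basis s B \<and>
     (\<forall>i. \<forall>l\<in>B. \<forall>k\<in>B. act_coeff s B i l k \<ge> 0)"

definition based_module :: "(rS4 \<Rightarrow> 'm \<Rightarrow> 'm) \<Rightarrow> 'm :: ab_group_add set \<Rightarrow> bool" where
  "based_module s B \<longleftrightarrow> Zplus_module s B \<and>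
     (\<forall>i. \<forall>l\<in>B. \<forall>k\<in>B. act_coeff s B i l k = act_coeff s B i k l)"

definition irreducible_Zplus_module ::
  "(rS4 \<Rightarrow> 'm \<Rightarrow> 'm) \<Rightarrow> 'm :: ab_group_add set \<Rightarrow> bool" where
  "irreducible_Zplus_module s B \<longleftrightarrow> Zplus_module s B \<and> (UNIV :: 'm set) \<noteq> {0} \<and>
     (\<forall>S. S \<subseteq> B \<and> S \<noteq> {} \<and> S \<noteq> B \<longrightarrow>
        \<not> module.subspace s (module.span (int_scale s) S))"

definition Zplus_equivalent ::
  "(rS4 \<Rightarrow> 'm \<Rightarrow> 'm) \<Rightarrow> 'm :: ab_group_add set \<Rightarrow>
   (rS4 \<Rightarrow> 'n \<Rightarrow> 'n) \<Rightarrow> 'n :: ab_group_add set \<Rightarrow> bool" where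
  "Zplus_equivalent s B s' B' \<longleftrightarrow>
     (\<exists>f. module_hom s s' f \<and> bij f \<and> bij_betw f B B')"

section \<open>The three modules of rank two\<close>

text \<open>
  The action on \<open>\<int>\<^sup>2\<close> in which \<open>V Psi\<close>, \<open>V Rho1\<close>, \<open>V Rho2\<close> act by the matrices \<open>A\<close>, \<open>T\<close>, \<open>R\<close> and
  \<open>V Rho3\<close> by \<open>A ** R\<close>.
\<close>

definition matrix_action ::
  "int^2^2 \<Rightarrow> int^2^2 \<Rightarrow> int^2^2 \<Rightarrow> rS4 \<Rightarrow> int^2 \<Rightarrow> int^2" where
  "matrix_action A T R r v =
     coord r Triv *s v + coord r Psi *s (A *v v) + coord r Rho1 *s (T *v v) +
     coord r Rho2 *s (R *v v) + coord r Rho3 *s ((A ** R) *v v)"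

definition std_basis :: "(int^2) set" where
  "std_basis = {axis 1 1, axis 2 1}"

definition M_2_1 :: "rS4 \<Rightarrow> int^2 \<Rightarrow> int^2" where
  "M_2_1 = matrix_action
     (vector [vector [1, 0], vector [0, 1]])
     (vector [vector [2, 0], vector [0, 2]])
     (vector [vector [1, 2], vector [2, 1]])"

definition M_2_2 :: "rS4 \<Rightarrow> int^2 \<Rightarrow> int^2" where
  "M_2_2 = matrix_action
     (vector [vector [0, 1], vector [1, 0]])
     (vector [vector [1, 1], vector [1, 1]])
     (vector [vector [2, 1], vector [1, 2]])"

definition M_2_3 :: "rS4 \<Rightarrow> int^2 \<Rightarrow> int^2" where
  "M_2_3 = matrix_action
     (vector [vector [0, 1], vector [1, 0]])
     (vector [vector [1, 1], vector [1, 1]])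
     (vector [vector [1, 2], vector [2, 1]])"

lemma matrix_action_component:
  "matrix_action A T R r v $ i =
     coord r Triv * v $ i + coord r Psi * (A $ i $ 1 * v $ 1 + A $ i $ 2 * v $ 2) +
     coord r Rho1 * (T $ i $ 1 * v $ 1 + T $ i $ 2 * v $ 2) +
     coord r Rho2 * (R $ i $ 1 * v $ 1 + R $ i $ 2 * v $ 2) +
     coord r Rho3 *
       ((A $ i $ 1 * R $ 1 $ 1 + A $ i $ 2 * R $ 2 $ 1) * v $ 1 +
        (A $ i $ 1 * R $ 1 $ 2 + A $ i $ 2 * R $ 2 $ 2) * v $ 2)"
  by (simp add: matrix_action_def matrix_vector_mult_def matrix_matrix_mult_def sum_2)

lemma module_matrix_action:
  assumes "\<And>r r' v. matrix_action A T R (r * r') v =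
    matrix_action A T R r (matrix_action A T R r' v)"
  shows "module (matrix_action A T R)"
proof
  fix r r' :: rS4 and v w :: "int^2"
  show "matrix_action A T R r (v + w) = matrix_action A T R r v + matrix_action A T R r w"
    by (simp add: vec_eq_iff matrix_action_component algebra_simps)
  show "matrix_action A T R (r + r') v = matrix_action A T R r v + matrix_action A T R r' v"
    by (simp add: vec_eq_iff matrix_action_component plus_rS4_def algebra_simps)
  show "matrix_action A T R r (matrix_action A T R r' v) = matrix_action A T R (r * r') v"
    by (simp add: assms)
  show "matrix_action A T R 1 v = v"
    by (simp add: vec_eq_iff matrix_action_component one_rS4_def)
qed

lemma module_M_2: "module M_2_1" "module M_2_2" "module M_2_3"
  unfolding M_2_1_def M_2_2_def M_2_3_def
  by (rule module_matrix_action,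
      simp add: vec_eq_iff forall_2 matrix_action_component coord_times; algebra)+

lemma of_int_rS4: "of_int n = RS4 (\<lambda>k. if k = Triv then n else 0)"
proof -
  have nat: "of_nat m = RS4 (\<lambda>k. if k = Triv then int m else 0)" for m
    by (induction m) (auto simp: zero_rS4_def one_rS4_def plus_rS4_def)
  show ?thesis
    by (cases n) (auto simp: nat uminus_rS4_def one_rS4_def plus_rS4_def minus_rS4_def fun_eq_iff)
qed

lemma int_scale_matrix_action: "int_scale (matrix_action A T R) = (*s)"
  by (intro ext) (simp add: vec_eq_iff int_scale_def matrix_action_component of_int_rS4)

lemma module_int_vec: "module ((*s) :: int \<Rightarrow> int^2 \<Rightarrow> int^2)"
  by standard (auto simp: vec_eq_iff algebra_simps)

lemma std_basis_expand: "v = v $ 1 *s axis 1 1 + v $ 2 *s axis 2 (1 :: int)" for v :: "int^2"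
  by (simp add: vec_eq_iff forall_2 axis_def)

lemma axis_neq: "axis 1 1 \<noteq> (axis 2 1 :: int^2)"
  by (simp add: axis_eq_axis)

lemma std_basis_independent: "\<not> module.dependent (*s) std_basis"
proof -
  interpret module "(*s) :: int \<Rightarrow> int^2 \<Rightarrow> int^2" by (rule module_int_vec)
  have "u (axis 1 1) = 0 \<and> u (axis 2 1) = 0"
    if "(\<Sum>v\<in>std_basis. u v *s v) = 0" for u :: "int^2 \<Rightarrow> int"
    using that axis_neq by (simp add: std_basis_def vec_eq_iff forall_2 axis_def)
  then show ?thesis
    by (auto simp: dependent_finite std_basis_def)
qed

lemma std_basis_span: "module.span (*s) std_basis = (UNIV :: (int^2) set)"
proof -
  interpret module "(*s) :: int \<Rightarrow> int^2 \<Rightarrow> int^2" by (rule module_int_vec)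
  have "v \<in> span std_basis" for v :: "int^2"
    by (subst std_basis_expand)
      (intro span_add span_scale span_base; simp add: std_basis_def)
  then show ?thesis by auto
qed

lemma std_basis_representation:
  "module.representation (*s) std_basis (v :: int^2) (axis i 1) = v $ i"
proof -
  interpret module "(*s) :: int \<Rightarrow> int^2 \<Rightarrow> int^2" by (rule module_int_vec)
  have mem: "axis j 1 \<in> std_basis" for j :: 2
    using exhaust_2[of j] by (auto simp: std_basis_def)
  have e: "representation std_basis (axis j 1) (axis i 1) = (if i = j then 1 else 0)" for j :: 2
    using representation_basis[OF std_basis_independent mem[of j]] by (auto simp: axis_eq_axis)
  show ?thesis
    using exhaust_2[of i]
    by (subst std_basis_expand)
      (auto simp: representation_add representation_scale std_basis_independent std_basis_span e)
qed

lemma irreducible_based_matrix_action: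
  fixes A T R :: "int^2^2"
  defines "s \<equiv> matrix_action A T R"
  assumes "module s"
    and nonneg: "\<forall>i. \<forall>j k. s (V i) (axis j 1) $ k \<ge> 0"
    and sym: "\<forall>i. \<forall>j k. s (V i) (axis j 1) $ k = s (V i) (axis k 1) $ j"
    and conn: "R $ 1 $ 2 \<noteq> 0" "R $ 2 $ 1 \<noteq> 0"
  shows "irreducible_Zplus_module s std_basis \<and> based_module s std_basis"
proof -
  interpret Z: module "(*s) :: int \<Rightarrow> int^2 \<Rightarrow> int^2" by (rule module_int_vec)
  interpret module s by fact
  have int_sc: "int_scale s = (*s)"
    by (simp add: s_def int_scale_matrix_action)
  have basis_ax: "\<exists>j. l = axis j 1" if "l \<in> std_basis" for l
    using that by (auto simp: std_basis_def)
  have zp: "Zplus_module s std_basis"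
    using assms(2) nonneg std_basis_independent std_basis_span
    by (auto simp: Zplus_module_def is_Z_basis_def int_sc act_coeff_def std_basis_representation
        dest!: basis_ax)
  have bm: "based_module s std_basis"
    using zp sym
    by (auto simp: based_module_def int_sc act_coeff_def std_basis_representation dest!: basis_ax)
  have no: "\<not> subspace (Z.span {axis j 1})" for j
  proof
    assume "subspace (Z.span {axis j 1})"
    then have "s (V Rho2) (axis j 1) \<in> Z.span {axis j 1}"
      by (rule subspace_scale) (simp add: Z.span_base)
    then obtain c where "s (V Rho2) (axis j 1) = c *s axis j 1"
      by (auto simp: Z.span_singleton)
    then show False
      using conn exhaust_2[of j]
      by (auto simp: s_def vec_eq_iff forall_2 matrix_action_component V_def axis_def)
  qed
  have "S = {axis 1 1} \<or> S = {axis 2 1}" if "S \<subseteq> std_basis" "S \<noteq> {}" "S \<noteq> std_basis" for S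
    using that by (auto simp: std_basis_def)
  moreover have "(UNIV :: (int^2) set) \<noteq> {0}"
    by (metis UNIV_I axis_eq_0_iff singletonD zero_neq_one)
  ultimately show ?thesis
    using zp bm no by (auto simp: irreducible_Zplus_module_def int_sc)
qed

lemma irreducible_based_M_2:
  "irreducible_Zplus_module M_2_1 std_basis \<and> based_module M_2_1 std_basis"
  "irreducible_Zplus_module M_2_2 std_basis \<and> based_module M_2_2 std_basis"
  "irreducible_Zplus_module M_2_3 std_basis \<and> based_module M_2_3 std_basis"
proof -
  show "irreducible_Zplus_module M_2_1 std_basis \<and> based_module M_2_1 std_basis"
    unfolding M_2_1_def
    by (rule irreducible_based_matrix_action[OF module_M_2(1)[unfolded M_2_1_def]])
      (simp_all add: all_irr forall_2 matrix_action_component V_def axis_def)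
  show "irreducible_Zplus_module M_2_2 std_basis \<and> based_module M_2_2 std_basis"
    unfolding M_2_2_def
    by (rule irreducible_based_matrix_action[OF module_M_2(2)[unfolded M_2_2_def]])
      (simp_all add: all_irr forall_2 matrix_action_component V_def axis_def)
  show "irreducible_Zplus_module M_2_3 std_basis \<and> based_module M_2_3 std_basis"
    unfolding M_2_3_def
    by (rule irreducible_based_matrix_action[OF module_M_2(3)[unfolded M_2_3_def]])
      (simp_all add: all_irr forall_2 matrix_action_component V_def axis_def)
qed

lemma card_std_basis: "card std_basis = 2"
  using axis_neq by (simp add: std_basis_def)

end

theory Submission
  imports Defs
begin

text \<open>
  Coordinates with respect to the basis turn the action into a ring homomorphism from \<open>r(S\<^sub>4)\<close> to
  integral \<open>2 \<times> 2\<close> matrices. The images \<open>P\<close>, \<open>T\<close>, \<open>R\<close> of \<open>V Psi\<close>, \<open>V Rho1\<close>, \<open>V Rho2\<close> are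
  symmetric and non-negative, and \<open>P\<^sup>2 = 1\<close>, so \<open>P\<close> is the identity or the swap.
  If \<open>P = 1\<close>, then \<open>T\<^sup>2 = 2 + T\<close> forces \<open>T = 2\<close>, and
  \<open>R\<^sup>2 = 3 + 2 R\<close> with \<open>R\<close> not diagonal (by irreducibility) forces \<open>R\<close>. If \<open>P\<close> is the swap, then
  \<open>P T = T\<close> makes all entries of \<open>T\<close> equal, and the symmetry of \<open>P R\<close> gives \<open>R\<close> a constant
  diagonal \<open>x\<close> and off-diagonal \<open>y\<close> with \<open>(x - y)\<^sup>2 = 1\<close>. All three solutions are invariant under
  exchanging the two basis vectors, so any bijection of bases is an equivalence.
\<close>

text \<open>Determines the action of every ring element by those of the nontrivial
  irreducibles.\<close>

lemma rS4_expand: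
  "r = of_int (coord r Triv) + of_int (coord r Psi) * V Psi + of_int (coord r Rho1) * V Rho1 +
       of_int (coord r Rho2) * V Rho2 + of_int (coord r Rho3) * V Rho3"
  unfolding rS4_eq_iff all_irr
  by (simp add: coord_times plus_rS4_def of_int_rS4 V_def)

lemma mat2_eq_iff:
  "(X :: 'a ^ 2 ^ 2) = Y \<longleftrightarrow>
    X $ 1 $ 1 = Y $ 1 $ 1 \<and> X $ 1 $ 2 = Y $ 1 $ 2 \<and> X $ 2 $ 1 = Y $ 2 $ 1 \<and> X $ 2 $ 2 = Y $ 2 $ 2"
  by (auto simp: vec_eq_iff forall_2)

lemma mat2_mult:
  "((X :: 'a::semiring_1 ^ 2 ^ 2) ** Y) $ i $ j = X $ i $ 1 * Y $ 1 $ j + X $ i $ 2 * Y $ 2 $ j"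
  by (simp add: matrix_matrix_mult_def sum_2)

text \<open>Positivity, symmetry and irreducibility enter only later, as conditions on the matrices
  built here.\<close>

locale rank_two_module =
  fixes s :: "rS4 \<Rightarrow> 'm \<Rightarrow> 'm :: ab_group_add" and b1 b2 :: 'm
  assumes module_s: "module s"
    and basis: "is_Z_basis s {b1, b2}"
    and b1_neq_b2: "b1 \<noteq> b2"
begin

sublocale S: module s
  by (rule module_s)

sublocale Z: module "int_scale s"
  by standard (simp_all add: int_scale_def S.scale_right_distrib S.scale_left_distrib)

lemma independent: "\<not> Z.dependent {b1, b2}"
  and span: "Z.span {b1, b2} = UNIV"
  using basis by (auto simp: is_Z_basis_def)

definition coords :: "'m \<Rightarrow> int^2" where
  "coords v = vector [Z.representation {b1, b2} v b1, Z.representation {b1, b2} v b2]"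

lemma coords_add: "coords (v + w) = coords v + coords w"
  by (simp add: coords_def vec_eq_iff forall_2 Z.representation_add independent span)

lemma coords_scale: "coords (s (of_int n) v) = n *s coords v"
  using Z.representation_scale[OF independent, of v n]
  by (simp add: coords_def vec_eq_iff forall_2 span int_scale_def)

lemma coords_b1: "coords b1 = axis 1 1"
  and coords_b2: "coords b2 = axis 2 1"
  using b1_neq_b2 Z.representation_basis[OF independent, of b1]
    Z.representation_basis[OF independent, of b2]
  by (auto simp: coords_def vec_eq_iff forall_2 axis_def)

lemma expand: "v = s (of_int (coords v $ 1)) b1 + s (of_int (coords v $ 2)) b2"
  using Z.sum_representation_eq[OF independent, of v "{b1, b2}"] b1_neq_b2
  by (simp add: span coords_def int_scale_def)

lemma bij_coords: "bij coords"
proof (rule bijI)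
  show "inj coords"
    by (rule injI) (metis expand)
  show "surj coords"
  proof (rule surjI)
    fix x :: "int^2"
    show "coords (s (of_int (x $ 1)) b1 + s (of_int (x $ 2)) b2) = x"
      by (simp add: coords_add coords_scale coords_b1 coords_b2 std_basis_expand[symmetric])
  qed
qed

text \<open>The transpose makes the images of \<open>b1\<close> and \<open>b2\<close> the columns,
  so that matrices act on coordinate columns from the left.\<close>

definition rep_matrix :: "rS4 \<Rightarrow> int^2^2" where
  "rep_matrix r = transpose (vector [coords (s r b1), coords (s r b2)])"

lemma rep_matrix_nth:
  "rep_matrix r $ i $ 1 = coords (s r b1) $ i"
  "rep_matrix r $ i $ 2 = coords (s r b2) $ i"
  by (simp_all add: rep_matrix_def transpose_def)

lemma act_coeff_rep_matrix:
  "act_coeff s {b1, b2} i b1 b1 = rep_matrix (V i) $ 1 $ 1"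
  "act_coeff s {b1, b2} i b1 b2 = rep_matrix (V i) $ 2 $ 1"
  "act_coeff s {b1, b2} i b2 b1 = rep_matrix (V i) $ 1 $ 2"
  "act_coeff s {b1, b2} i b2 b2 = rep_matrix (V i) $ 2 $ 2"
  by (simp_all add: act_coeff_def rep_matrix_nth coords_def)

lemma coords_act: "coords (s r v) = rep_matrix r *v coords v"
proof -
  have "s r v = s r (s (of_int (coords v $ 1)) b1 + s (of_int (coords v $ 2)) b2)"
    using expand by simp
  also have "\<dots> = s (of_int (coords v $ 1)) (s r b1) + s (of_int (coords v $ 2)) (s r b2)"
    by (simp add: S.scale_right_distrib mult.commute)
  finally have "coords (s r v) = coords v $ 1 *s coords (s r b1) + coords v $ 2 *s coords (s r b2)"
    by (simp only: coords_add coords_scale)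
  then show ?thesis
    by (simp add: vec_eq_iff matrix_vector_mult_def sum_2 rep_matrix_nth mult.commute)
qed

lemma rep_matrix_one: "rep_matrix 1 = mat 1"
  by (simp add: mat2_eq_iff rep_matrix_nth coords_b1 coords_b2 axis_def mat_def)

lemma rep_matrix_add: "rep_matrix (r + r') = rep_matrix r + rep_matrix r'"
  by (simp add: mat2_eq_iff rep_matrix_nth S.scale_left_distrib coords_add)

lemma rep_matrix_mult: "rep_matrix (r * r') = rep_matrix r ** rep_matrix r'"
proof -
  have "coords (s (r * r') v) = rep_matrix r *v coords (s r' v)" for v
    by (simp flip: coords_act)
  then show ?thesis
    by (simp add: mat2_eq_iff mat2_mult rep_matrix_nth matrix_vector_mult_def sum_2)
qed

lemma coords_matrix_action:
  "coords (s r v) =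
     matrix_action (rep_matrix (V Psi)) (rep_matrix (V Rho1)) (rep_matrix (V Rho2)) r (coords v)"
proof -
  have "s r v = s (of_int (coord r Triv)) v + s (of_int (coord r Psi)) (s (V Psi) v) +
      s (of_int (coord r Rho1)) (s (V Rho1) v) + s (of_int (coord r Rho2)) (s (V Rho2) v) +
      s (of_int (coord r Rho3)) (s (V Rho3) v)"
    by (subst rS4_expand) (simp add: S.scale_left_distrib)
  then show ?thesis
    by (simp add: coords_add coords_scale matrix_action_def V_products(3)
        flip: coords_act rep_matrix_mult del: S.scale_scale)
qed

text \<open>The coordinate map itself is the equivalence.\<close>

lemma equivalent_matrix_action:
  assumes "module (matrix_action A T R)"
    and "rep_matrix (V Psi) = A" "rep_matrix (V Rho1) = T" "rep_matrix (V Rho2) = R"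
  shows "Zplus_equivalent s {b1, b2} (matrix_action A T R) std_basis"
  unfolding Zplus_equivalent_def
proof (intro exI conjI)
  show "module_hom s (matrix_action A T R) coords"
    using assms
    by (simp add: module_hom_def module_hom_axioms_def module_s coords_add coords_matrix_action)
  show "bij coords"
    by (rule bij_coords)
  show "bij_betw coords {b1, b2} std_basis"
    using axis_neq by (auto simp: bij_betw_def std_basis_def coords_b1 coords_b2)
qed

text \<open>The span of \<open>b1\<close> is the kernel of the second coordinate, which upper
  triangular matrices preserve. Its contrapositive turns irreducibility into a nonzero off-diagonal
  entry.\<close>

lemma reducible_if_triangular:
  assumes "\<And>i. rep_matrix (V i) $ 2 $ 1 = 0"
  shows "S.subspace (Z.span {b1})"
proof -
  have Z_span: "w \<in> Z.span {b1} \<longleftrightarrow> coords w $ 2 = 0" for w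
  proof
    assume "w \<in> Z.span {b1}"
    then show "coords w $ 2 = 0"
      by (auto simp: Z.span_singleton int_scale_def coords_scale coords_b1 axis_def)
  next
    assume "coords w $ 2 = 0"
    then have "w = int_scale s (coords w $ 1) b1"
      using expand[of w] by (simp add: int_scale_def)
    then show "w \<in> Z.span {b1}"
      by (auto simp: Z.span_singleton)
  qed
  have "(rep_matrix (V Psi) ** rep_matrix (V Rho2)) $ 2 $ 1 = 0"
    using assms by (simp add: mat2_mult)
  then have "coords (s r w) $ 2 = 0" if "coords w $ 2 = 0" for r w
    using that assms by (simp add: coords_matrix_action matrix_action_component mat2_mult)
  moreover have "coords 0 $ 2 = 0"
    using coords_scale[of 0 0] by simp
  ultimately show ?thesis
    by (simp add: S.subspace_def Z_span coords_add)
qed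

end

text \<open>The fourth symmetry assumption is that of \<open>V Rho3\<close>, which acts as
  \<open>P ** R\<close>.\<close>

lemma matrix_classification:
  fixes P T R :: "int^2^2"
  assumes nonneg: "\<And>i j. P $ i $ j \<ge> 0" "\<And>i j. T $ i $ j \<ge> 0" "\<And>i j. R $ i $ j \<ge> 0"
    and sym: "P $ 1 $ 2 = P $ 2 $ 1" "T $ 1 $ 2 = T $ 2 $ 1" "R $ 1 $ 2 = R $ 2 $ 1"
      "(P ** R) $ 1 $ 2 = (P ** R) $ 2 $ 1"
    and products: "P ** P = mat 1" "P ** T = T" "T ** T = mat 1 + P + T"
      "R ** R = mat 1 + T + R + P ** R"
    and not_diagonal: "\<not> (P $ 2 $ 1 = 0 \<and> T $ 2 $ 1 = 0 \<and> R $ 2 $ 1 = 0)"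
  shows "(P, T, R) \<in>
    {(vector [vector [1, 0], vector [0, 1]], vector [vector [2, 0], vector [0, 2]],
        vector [vector [1, 2], vector [2, 1]]),
     (vector [vector [0, 1], vector [1, 0]], vector [vector [1, 1], vector [1, 1]],
        vector [vector [2, 1], vector [1, 2]]),
     (vector [vector [0, 1], vector [1, 0]], vector [vector [1, 1], vector [1, 1]],
        vector [vector [1, 2], vector [2, 1]])}"
proof -
  obtain a b d where P: "P $ 1 $ 1 = a" "P $ 1 $ 2 = b" "P $ 2 $ 1 = b" "P $ 2 $ 2 = d"
    using sym by simp
  obtain t u w where T: "T $ 1 $ 1 = t" "T $ 1 $ 2 = u" "T $ 2 $ 1 = u" "T $ 2 $ 2 = w"
    using sym by simp
  obtain x y z where R: "R $ 1 $ 1 = x" "R $ 1 $ 2 = y" "R $ 2 $ 1 = y" "R $ 2 $ 2 = z"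
    using sym by simp
  note entries = mat2_eq_iff mat2_mult P T R mat_def
  have nn: "a \<ge> 0" "b \<ge> 0" "d \<ge> 0" "t \<ge> 0" "u \<ge> 0" "w \<ge> 0" "x \<ge> 0" "y \<ge> 0" "z \<ge> 0"
    using nonneg by (metis P T R)+
  have PP: "a * a + b * b = 1" "b * b + d * d = 1" "b * (a + d) = 0"
    using products(1) by (auto simp: entries algebra_simps)
  have TT: "t * t + u * u = 1 + a + t" "u * (t + w) = b + u" "u * u + w * w = 1 + d + w"
    using products(3) by (auto simp: entries algebra_simps)
  have sq: "n * n \<ge> 0" "n \<ge> 3 \<Longrightarrow> n * n \<ge> 3 * n" "n \<ge> 2 \<Longrightarrow> n * n \<ge> 2 * n" for n :: int
    by (auto intro: mult_right_mono)
  have "b \<le> 1"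
    using PP(1) sq(1)[of a] sq(3)[of b] by linarith
  then consider "b = 0" | "b = 1"
    using nn by linarith
  then show ?thesis
  proof cases
    case 1
    have "a = 1" "d = 1"
      using PP nn 1 by (auto simp: zmult_eq_1_iff)
    note vals = 1 this
    have RR: "x * x + y * y = 1 + t + 2 * x" "y * (x + z) = u + 2 * y" "y * y + z * z = 1 + w + 2 * z"
      using products(4) by (auto simp: entries vals algebra_simps)
    \<comment> \<open>Otherwise the off-diagonal entry of \<open>T ** T\<close> forces trace 1, so
      the diagonal entries are 0 and 1, and then \<open>u * u = 2\<close>.\<close>
    have "u = 0"
    proof (rule ccontr)
      assume "u \<noteq> 0"
      then have "t + w = 1" using TT(2) vals by simp
      then consider "t = 0" | "t = 1" using nn by linarith
      then have "u * u = 2" using TT vals by cases auto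
      moreover have "u = 1 \<or> u \<ge> 2" using \<open>u \<noteq> 0\<close> nn by linarith
      ultimately show False using sq(3)[of u] by auto
    qed
    have two: "n = 2" if "n * n = 2 + n" "n \<ge> 0" for n :: int
    proof -
      have "(n - 2) * (n + 1) = 0" using that by (simp add: algebra_simps)
      then show ?thesis using that by auto
    qed
    have tw: "t = 2" "w = 2"
      using two nn TT \<open>u = 0\<close> vals by auto
    have "y \<noteq> 0"
      using not_diagonal by (simp add: P T R vals \<open>u = 0\<close>)
    then have "x + z = 2" using RR(2) \<open>u = 0\<close> by simp
    then consider "x = 0" "z = 2" | "x = 1" "z = 1" | "x = 2" "z = 0"
      using nn by linarith
    \<comment> \<open>Diagonals (0, 2) and (2, 0) would need \<open>y * y = 3\<close>, but 3 is not
      a square.\<close>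
    then have xz: "(y * y = 3 \<or> y * y = 4) \<and> (y * y = 4 \<longrightarrow> x = 1 \<and> z = 1)"
      using RR(1) tw by cases simp_all
    have "y < 3" using xz sq(2)[of y] by linarith
    moreover have "y \<noteq> 1" using xz by auto
    ultimately have "y = 2" using \<open>y \<noteq> 0\<close> nn by linarith
    then show ?thesis
      using xz by (simp add: entries vals tw \<open>u = 0\<close>)
  next
    case 2
    have "a = 0" "d = 0"
      using PP 2 by auto
    note vals = 2 this
    have "a * t + b * u = t" "a * u + b * w = u"
      using products(2) by (simp_all add: entries)
    then have "t = u" "w = u"
      by (simp_all add: vals)
    have "2 * (u * u) = 1 + u"
      using TT(1) vals \<open>t = u\<close> by simp
    then have "(u - 1) * (2 * u + 1) = 0" by (simp add: algebra_simps)
    \<comment> \<open>The factor \<open>2 * u + 1\<close> is odd, hence nonzero.\<close>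
    then have "u = 1" by auto presburger
    have "z = x"
      using sym(4) by (simp add: entries vals)
    have RR: "x * x + y * y = 2 + x + y" "2 * (x * y) = 1 + x + y"
      using products(4) by (auto simp: entries vals \<open>t = u\<close> \<open>w = u\<close> \<open>u = 1\<close> \<open>z = x\<close> algebra_simps)
    \<comment> \<open>Subtract the two equations. Here \<open>x - y\<close> is the eigenvalue of
      \<open>R\<close> on (1, -1), where \<open>P\<close> acts as -1 and \<open>T\<close> as
      0.\<close>
    then have "(x - y) * (x - y) = 1" by (simp add: algebra_simps)
    then have "x = y + 1 \<or> y = x + 1"
      by (auto simp: zmult_eq_1_iff)
    then have "(x = 2 \<and> y = 1) \<or> (x = 1 \<and> y = 2)"
    proof
      assume xy: "x = y + 1"
      then have "(y - 1) * (y + 1) = 0" using RR(2) by (simp add: algebra_simps)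
      then show ?thesis using xy nn by auto
    next
      assume xy: "y = x + 1"
      then have "(x - 1) * (x + 1) = 0" using RR(2) by (simp add: algebra_simps)
      then show ?thesis using xy nn by auto
    qed
    then show ?thesis
      by (auto simp: entries vals \<open>t = u\<close> \<open>w = u\<close> \<open>u = 1\<close> \<open>z = x\<close>)
  qed
qed

theorem proposition3p2:
  fixes s :: "rS4 \<Rightarrow> 'm \<Rightarrow> 'm :: ab_group_add" and B :: "'m set"
  assumes "based_module s B" and "irreducible_Zplus_module s B" and "card B = 2"
  shows "Zplus_equivalent s B M_2_1 std_basis \<or>
         Zplus_equivalent s B M_2_2 std_basis \<or>
         Zplus_equivalent s B M_2_3 std_basis"
proof -
  obtain b1 b2 where B: "B = {b1, b2}" and neq: "b1 \<noteq> b2"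
    using \<open>card B = 2\<close> by (auto simp: card_2_iff)
  interpret rank_two_module s b1 b2
    by (rule rank_two_module.intro)
      (use assms(1) neq in \<open>simp_all add: based_module_def Zplus_module_def B\<close>)
  let ?M = "\<lambda>i. rep_matrix (V i)"
  have nonneg: "?M i $ j $ k \<ge> 0" for i j k
  proof -
    have "\<forall>l\<in>B. \<forall>k\<in>B. act_coeff s B i l k \<ge> 0"
      using assms(1) by (auto simp: based_module_def Zplus_module_def)
    then show ?thesis
      using exhaust_2[of j] exhaust_2[of k] by (auto simp: B act_coeff_rep_matrix)
  qed
  have sym: "?M i $ 1 $ 2 = ?M i $ 2 $ 1" for i
  proof -
    have "act_coeff s B i b2 b1 = act_coeff s B i b1 b2"
      using assms(1) unfolding based_module_def B by blast
    then show ?thesis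
      by (simp add: B act_coeff_rep_matrix)
  qed
  \<comment> \<open>\<open>{b1}\<close> is a nonempty proper subset of the basis.\<close>
  have "\<not> S.subspace (Z.span {b1})"
    using assms(2) neq by (auto simp: irreducible_Zplus_module_def B)
  then obtain i where i: "?M i $ 2 $ 1 \<noteq> 0"
    using reducible_if_triangular by blast
  have Rho3: "?M Psi ** ?M Rho2 = ?M Rho3"
    by (simp flip: rep_matrix_mult V_products(3))
  \<comment> \<open>The index \<open>i\<close> may also be \<open>Triv\<close> or
    \<open>Rho3\<close>: the former acts as the identity, and the latter as a product whose lower
    left entry vanishes when those of both factors do.\<close>
  have not_diagonal: "\<not> (?M Psi $ 2 $ 1 = 0 \<and> ?M Rho1 $ 2 $ 1 = 0 \<and> ?M Rho2 $ 2 $ 1 = 0)"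
    using i by (cases i) (auto simp: V_Triv rep_matrix_one mat_def mat2_mult simp flip: Rho3)
  have "(?M Psi, ?M Rho1, ?M Rho2) \<in>
    {(vector [vector [1, 0], vector [0, 1]], vector [vector [2, 0], vector [0, 2]],
        vector [vector [1, 2], vector [2, 1]]),
     (vector [vector [0, 1], vector [1, 0]], vector [vector [1, 1], vector [1, 1]],
        vector [vector [2, 1], vector [1, 2]]),
     (vector [vector [0, 1], vector [1, 0]], vector [vector [1, 1], vector [1, 1]],
        vector [vector [1, 2], vector [2, 1]])}"
    by (rule matrix_classification)
      (use nonneg sym not_diagonal in \<open>simp_all add: Rho3 V_products rep_matrix_add rep_matrix_one
        flip: rep_matrix_mult\<close>)
  then show ?thesis
    unfolding B M_2_1_def M_2_2_def M_2_3_def insert_iff empty_iff prod.inject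
    using module_M_2[unfolded M_2_1_def M_2_2_def M_2_3_def]
    by (elim disjE conjE FalseE; blast intro: equivalent_matrix_action)
qed

end
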